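(* Let $(\mathcal{X},d)$ be a complete metric space, let $f\colon\mathcal{X}\to\mathbb{R}\cup\{+\infty\}$ be a closed function, and let $x\in\mathcal{X}$ be a point with $f(x)$ finite. Let $S\subseteq\mathcal{X}$ be an arbitrary set and let $x^*\in S$ be a point such that, for some constants $L>0$ and $\gamma>0$, the slope error-bound $$\operatorname{dist}(u;S)\leq L\cdot|\nabla f|(u)\quad\text{for all } u\in\mathbf{B}_\gamma(x^* )$$ holds. Let $f_x\colon\mathcal{X}\to\mathbb{R}\cup\{+\infty\}$ be a closed function such that for some $\eta>0$ $$|f_x(y)-f(y)|\leq\frac{\eta}{2}d^2(y,x)\quad\text{for all } y\in\mathcal{X}.$$ Then the following model error-bound holds: $$\operatorname{dist}(x;S)\leq\left(L\sqrt{12\eta}+\frac{2}{\sqrt{3\eta}}\right)\cdot\sqrt{f(x)-\inf f_x},$$ whenever $f(x)-\inf f_x<\frac{3\eta\gamma^2}{16}$ and $x\in\mathbf{B}_{\gamma/2}(x^* )$.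
   Context: A function on a metric space is called closed if it is lower-semicontinuous. $\mathbf{B}_r(x)$ is the open ball of radius $r$ around $x$ and $\operatorname{dist}(x;S)=\inf_{y\in S}d(x,y)$. The slope of $f$ at a point $\bar x$ with $f(\bar x)$ finite is $|\nabla f|(\bar x):=\limsup_{x\to\bar x,\,x\ne\bar x}\frac{(f(\bar x)-f(x))^+}{d(\bar x,x)}$, where $r^+=\max\{0,r\}$ (it is $0$ if $\bar x$ is isolated); by convention $|\nabla f|(\bar x)=+\infty$ where $f(\bar x)=+\infty$. The inequality $|f_x(y)-f(y)|\le\frac{\eta}{2}d^2(y,x)$ is understood to mean that $f_x(y)$ and $f(y)$ are either both $+\infty$ or both finite and satisfying the inequality. *)

theory Defs
  imports "HOL-Analysis.Analysis"
begin

(* A function with values in R \<union> {+\<infinity>} is an ereal-valued function omitting -\<infinity>. *)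
definition never_minf :: "('a \<Rightarrow> ereal) \<Rightarrow> bool" where
  "never_minf f \<longleftrightarrow> (\<forall>x. f x \<noteq> -\<infinity>)"

(* At an isolated point "at x" is the trivial filter and Liminf over it is +\<infinity>,
   so the condition is vacuous there, as it should be. *)
definition closed_fun :: "('a::metric_space \<Rightarrow> ereal) \<Rightarrow> bool" where
  "closed_fun f \<longleftrightarrow> (\<forall>x. f x \<le> Liminf (at x) f)"

(* Limsup over the trivial filter is -\<infinity>, so isolated points are treated separately.
   Where f u = +\<infinity> and f x is finite, the quotient is max 0 (-\<infinity>) / dist x u = 0. *)
definition slope :: "('a::metric_space \<Rightarrow> ereal) \<Rightarrow> 'a \<Rightarrow> ereal" where
  "slope f x =
     (if f x = \<infinity> then \<infinity>
      else if open {x} then 0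
      else Limsup (at x) (\<lambda>u. max 0 (f x - f u) / ereal (dist x u)))"

(* "|a - b| \<le> r" for a, b in R \<union> {+\<infinity>}; the first disjunct is needed because
   \<infinity> - \<infinity> = \<infinity> in ereal. *)
definition close_within :: "ereal \<Rightarrow> ereal \<Rightarrow> real \<Rightarrow> bool" where
  "close_within a b r \<longleftrightarrow>
     (a = \<infinity> \<and> b = \<infinity>) \<or> (\<bar>a\<bar> \<noteq> \<infinity> \<and> \<bar>b\<bar> \<noteq> \<infinity> \<and> \<bar>a - b\<bar> \<le> ereal r)"

end

theory Submission
  imports Defs
begin

text \<open>
  Put \<open>g y = f y + \<eta>/2 d(y, x)\<^sup>2\<close> and \<open>\<Delta> = f x - inf fx\<close>. The model inequality gives
  \<open>g \<ge> inf fx\<close>, so \<open>x\<close> minimises \<open>g\<close> up to \<open>\<Delta>\<close>. Ekeland's principle at radius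
  \<open>r = 2 sqrt (\<Delta> / (3\<eta>))\<close>, which the gap condition makes smaller than \<open>\<gamma>/2\<close>, produces \<open>u\<close>
  within \<open>r\<close> of \<open>x\<close> where the slope of \<open>g\<close> is at most \<open>\<Delta> / r\<close>. The quadratic term changes
  the slope by at most \<open>\<eta> r\<close>, so the slope of \<open>f\<close> at \<open>u\<close> is below \<open>sqrt (12 \<eta> \<Delta>)\<close>, and the
  slope error bound at \<open>u\<close> transfers to \<open>x\<close> by the triangle inequality.
\<close>

text \<open>A level \<open>c\<close> below the sum at \<open>x\<close> splits into reals
  \<open>r < f x\<close> and \<open>s - r < k x\<close> with \<open>c \<le> s\<close>, and both
  strict bounds persist near \<open>x\<close>. The real \<open>s\<close> stands in for
  \<open>c\<close>, which may be -\<infinity>.\<close>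

lemma closed_fun_add_continuous:
  fixes f :: "'a::metric_space \<Rightarrow> ereal" and k :: "'a \<Rightarrow> real"
  assumes "closed_fun f" and "continuous_on UNIV k"
  shows "closed_fun (\<lambda>z. f z + ereal (k z))"
  unfolding closed_fun_def le_Liminf_iff
proof (intro allI impI)
  fix x c assume c: "c < f x + ereal (k x)"
  then have "c - ereal (k x) < f x"
    by (cases c; cases "f x") auto
  then obtain r where r: "c - ereal (k x) < ereal r" "ereal r < f x"
    using ereal_dense2 by blast
  have "\<forall>\<^sub>F z in at x. ereal r < f z"
    using assms(1) r(2) unfolding closed_fun_def le_Liminf_iff by blast
  moreover obtain s where s: "c \<le> ereal s" "s - r < k x"
  proof (cases c)
    case (real c')
    then show thesis using r(1) that[of c'] by (simp add: algebra_simps)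
  next
    case MInf
    then show thesis using that[of "r + k x - 1"] by simp
  qed (use c in auto)
  have "(k \<longlongrightarrow> k x) (at x)"
    using assms(2) by (simp add: continuous_on_def)
  then have "\<forall>\<^sub>F z in at x. s - r < k z"
    using s(2) by (rule order_tendstoD)
  ultimately show "\<forall>\<^sub>F z in at x. c < f z + ereal (k z)"
  proof eventually_elim
    case (elim z)
    then show ?case using s(1) by (cases c; cases "f z") auto
  qed
qed

lemma closed_fun_closed_sublevel:
  fixes f :: "'a::metric_space \<Rightarrow> ereal"
  assumes "closed_fun f"
  shows "closed {z. f z \<le> c}"
proof -
  have "open {z. c < f z}"
  proof (subst open_subopen, safe)
    fix x assume x: "c < f x"
    then have "\<forall>\<^sub>F z in at x. c < f z"
      using assms unfolding closed_fun_def le_Liminf_iff by blast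
    with x have "\<forall>\<^sub>F z in nhds x. c < f z"
      by (simp add: eventually_nhds_conv_at)
    then show "\<exists>T. open T \<and> x \<in> T \<and> T \<subseteq> {z. c < f z}"
      by (auto simp: eventually_nhds)
  qed
  moreover have "- {z. f z \<le> c} = {z. c < f z}"
    by auto
  ultimately show ?thesis
    by (simp add: closed_def)
qed

text \<open>With \<sigma> the ratio of gap to radius, the first conclusion keeps \<open>u\<close>
  near \<open>x\<close> and the second bounds the slope of \<open>g\<close> at \<open>u\<close> by
  \<sigma>.\<close>

theorem ekeland:
  fixes g :: "'a::complete_space \<Rightarrow> ereal" and m \<sigma> :: real
  assumes closed: "closed_fun g" and bdd: "\<And>y. ereal m \<le> g y"
    and fin: "g x \<noteq> \<infinity>" and \<sigma>: "\<sigma> > 0"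
  obtains u where "g u + ereal (\<sigma> * dist u x) \<le> g x"
    and "\<And>y. g u \<le> g y + ereal (\<sigma> * dist y u)"
proof -
  \<comment> \<open>The sets \<open>T y\<close> are closed and nest along \<open>z \<in> T y\<close>; choosing successive
    near-minimisers of \<open>g\<close> on them makes their diameters tend to 0.\<close>
  define T where "T y = {z. g z + ereal (\<sigma> * dist z y) \<le> g y}" for y
  have self: "y \<in> T y" for y
    by (simp add: T_def)
  have T_closed: "closed (T y)" for y
    unfolding T_def
    by (intro closed_fun_closed_sublevel closed_fun_add_continuous closed continuous_intros)
  have T_trans: "T z \<subseteq> T y" if "z \<in> T y" for y z
  proof
    fix w assume "w \<in> T z"
    have "\<sigma> * dist w y \<le> \<sigma> * dist w z + \<sigma> * dist z y"
      using \<sigma> dist_triangle[of w y z] by (simp flip: distrib_left)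
    moreover have "g w + ereal (\<sigma> * dist w z) \<le> g z" "g z + ereal (\<sigma> * dist z y) \<le> g y"
      using \<open>w \<in> T z\<close> that by (auto simp: T_def)
    ultimately show "w \<in> T y"
      unfolding T_def by (cases "g w"; cases "g z"; cases "g y") auto
  qed
  have step: "\<exists>z. g z \<noteq> \<infinity> \<and> z \<in> T y \<and> (\<forall>w\<in>T y. g z \<le> g w + ereal ((1/2) ^ n))"
    if "g y \<noteq> \<infinity>" for y n
  proof -
    let ?I = "INF w\<in>T y. g w"
    have "ereal m \<le> ?I" by (intro INF_greatest bdd)
    moreover have "?I \<le> g y" by (intro INF_lower self)
    ultimately have "\<bar>?I\<bar> \<noteq> \<infinity>" using that by (cases "?I") auto
    then have "?I < ?I + ereal ((1/2) ^ n)"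
      by (cases "?I") auto
    then obtain z where z: "z \<in> T y" "g z < ?I + ereal ((1/2) ^ n)"
      by (subst (asm) INF_less_iff) blast
    have "g z \<le> g w + ereal ((1/2) ^ n)" if "w \<in> T y" for w
      using z(2) INF_lower[OF that, of g]
      by (meson add_right_mono less_imp_le order_trans)
    moreover have "g z \<noteq> \<infinity>" using z(2) by auto
    ultimately show ?thesis using z(1) by blast
  qed
  \<comment> \<open>Finiteness of \<open>g (v n)\<close> is the invariant that \<open>step\<close>
    needs; the implication at \<open>n = 0\<close> fixes the starting point.\<close>
  have "\<exists>v. \<forall>n. (g (v n) \<noteq> \<infinity> \<and> (n = 0 \<longrightarrow> v n = x)) \<and>
      (v (Suc n) \<in> T (v n) \<and> (\<forall>w\<in>T (v n). g (v (Suc n)) \<le> g w + ereal ((1/2) ^ n)))"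
  proof (rule dependent_nat_choice)
    show "\<exists>y. g y \<noteq> \<infinity> \<and> ((0::nat) = 0 \<longrightarrow> y = x)" using fin by blast
  next
    fix y and n :: nat assume "g y \<noteq> \<infinity> \<and> (n = 0 \<longrightarrow> y = x)"
    then show "\<exists>z. (g z \<noteq> \<infinity> \<and> (Suc n = 0 \<longrightarrow> z = x)) \<and>
      z \<in> T y \<and> (\<forall>w\<in>T y. g z \<le> g w + ereal ((1/2) ^ n))"
      using step by auto
  qed
  then obtain v where v_fin: "\<And>n. g (v n) \<noteq> \<infinity>" and v0: "v 0 = x"
    and v_T: "\<And>n. v (Suc n) \<in> T (v n)"
    and v_min: "\<And>n w. w \<in> T (v n) \<Longrightarrow> g (v (Suc n)) \<le> g w + ereal ((1/2) ^ n)"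
    by metis
  have T_anti: "T (v n) \<subseteq> T (v m)" if "m \<le> n" for m n
    using lift_Suc_antimono_le[of "\<lambda>n. T (v n)", OF T_trans[OF v_T] that] .
  \<comment> \<open>By nesting, \<open>w\<close> also competed when \<open>v (Suc n)\<close> was
    chosen, so \<open>g\<close> can drop by at most \<open>(1/2) ^ n\<close> from there to
    \<open>w\<close>.\<close>
  have small: "\<sigma> * dist w (v (Suc n)) \<le> (1/2) ^ n" if w: "w \<in> T (v (Suc n))" for w n
  proof -
    have "g w + ereal (\<sigma> * dist w (v (Suc n))) \<le> g (v (Suc n))"
      using w by (simp add: T_def)
    moreover have "g (v (Suc n)) \<le> g w + ereal ((1/2) ^ n)"
      using v_min T_trans[OF v_T] w by blast
    ultimately show ?thesis
      using v_fin[of "Suc n"] bdd[of w] by (cases "g w"; cases "g (v (Suc n))") auto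
  qed
  have diam: "\<exists>n. \<forall>y\<in>T (v n). \<forall>z\<in>T (v n). dist y z < e" if e: "e > 0" for e
  proof -
    obtain n where n: "(1/2::real) ^ n < \<sigma> * e / 2"
      using real_arch_pow_inv[of "\<sigma> * e / 2" "1/2"] \<sigma> e by auto
    have "dist y (v (Suc n)) < e / 2" if "y \<in> T (v (Suc n))" for y
    proof -
      have "\<sigma> * dist y (v (Suc n)) < \<sigma> * (e / 2)"
        using small[OF that] n by simp
      then show ?thesis using \<sigma> by simp
    qed
    then show ?thesis
      by (meson dist_triangle_half_l dist_commute)
  qed
  obtain u where u: "(\<Inter>n. T (v n)) = {u}"
    using decreasing_closed_nest_sing[of "\<lambda>n. T (v n)"] T_closed self T_anti diam
    by (metis (no_types, lifting) empty_iff full_SetCompr_eq)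
  show thesis
  proof
    show "g u + ereal (\<sigma> * dist u x) \<le> g x"
      using u v0 unfolding T_def by auto
  next
    fix y
    show "g u \<le> g y + ereal (\<sigma> * dist y u)"
    proof (rule ccontr)
      assume neg: "\<not> ?thesis"
      \<comment> \<open>Failure of the bound puts \<open>y\<close> in every \<open>T (v n)\<close>,
        hence \<open>y = u\<close>, where the bound is trivial.\<close>
      then have "y \<in> T u" by (simp add: T_def)
      moreover have "u \<in> T (v n)" for n using u by blast
      ultimately have "y \<in> (\<Inter>n. T (v n))" using T_trans by blast
      with u neg show False by simp
    qed
  qed
qed

text \<open>Dividing by the distance bounds the quotient by \<open>B + C * dist y u\<close>; the
  quadratic term vanishes in the limit.\<close>

lemma slope_le:
  fixes f :: "'a::metric_space \<Rightarrow> ereal"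
  assumes fin: "\<bar>f u\<bar> \<noteq> \<infinity>" and B: "B \<ge> 0" and C: "C \<ge> 0"
    and le: "\<And>y. f u \<le> f y + ereal (B * dist y u + C * (dist y u)\<^sup>2)"
  shows "slope f u \<le> ereal B"
proof (cases "open {u}")
  case True
  then show ?thesis using fin B by (auto simp: slope_def)
next
  case False
  then have nontriv: "at u \<noteq> bot" by (simp add: at_eq_bot_iff)
  have "Limsup (at u) (\<lambda>y. max 0 (f u - f y) / ereal (dist u y))
      \<le> Limsup (at u) (\<lambda>y. ereal (B + C * dist y u))"
  proof (rule Limsup_mono, unfold eventually_at_filter, intro always_eventually allI impI)
    fix y assume "y \<noteq> u"
    then have d: "dist u y > 0" by simp
    have "max 0 (f u - f y) \<le> ereal ((B + C * dist y u) * dist u y)"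
      using le[of y] fin B C
      by (cases "f u"; cases "f y")
        (auto simp: algebra_simps power2_eq_square dist_commute)
    then show "max 0 (f u - f y) / ereal (dist u y) \<le> ereal (B + C * dist y u)"
      using d by (simp add: ereal_divide_le_pos mult.commute)
  qed
  also have "\<dots> = ereal (B + C * dist u u)"
    by (rule lim_imp_Limsup[OF nontriv], intro tendsto_intros)
  finally show ?thesis using False fin by (auto simp: slope_def)
qed

theorem corollary5p7:
  fixes f fx :: "'a::complete_space \<Rightarrow> ereal"
    and x xstar :: 'a
    and S :: "'a set"
    and L \<gamma> \<eta> :: real
  assumes f_range: "never_minf f"
    and f_closed: "closed_fun f"
    and f_finite: "\<bar>f x\<bar> \<noteq> \<infinity>"
    and xstar: "xstar \<in> S"
    and L_pos: "L > 0"
    and gamma_pos: "\<gamma> > 0"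
    and slope_bound: "\<And>u. u \<in> ball xstar \<gamma> \<Longrightarrow> ereal (infdist u S) \<le> ereal L * slope f u"
    and fx_range: "never_minf fx"
    and fx_closed: "closed_fun fx"
    and eta_pos: "\<eta> > 0"
    and model: "\<And>y. close_within (fx y) (f y) (\<eta> / 2 * (dist y x)\<^sup>2)"
    and gap: "f x - (INF y. fx y) < ereal (3 * \<eta> * \<gamma>\<^sup>2 / 16)"
    and near: "x \<in> ball xstar (\<gamma> / 2)"
  shows "infdist x S \<le> (L * sqrt (12 * \<eta>) + 2 / sqrt (3 * \<eta>)) *
           sqrt (real_of_ereal (f x - (INF y. fx y)))"
proof -
  obtain a where a: "f x = ereal a" using f_finite by auto
  have "fx x = f x"
    using model[of x] a by (cases "fx x") (auto simp: close_within_def)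
  then have "(INF y. fx y) \<le> ereal a"
    using INF_lower[of x UNIV fx] a by simp
  \<comment> \<open>The gap condition rules out an infimum of -\<infinity>, since the gap would then
    be +\<infinity>.\<close>
  with gap a obtain m where m: "(INF y. fx y) = ereal m" "m \<le> a"
    by (cases "INF y. fx y") auto
  define \<Delta> where "\<Delta> = a - m"
  have \<Delta>: "\<Delta> \<ge> 0" "\<Delta> < 3 * \<eta> * \<gamma>\<^sup>2 / 16" "real_of_ereal (f x - (INF y. fx y)) = \<Delta>"
    using m gap a by (auto simp: \<Delta>_def)
  \<comment> \<open>In these terms the radius is \<open>2 * t / s\<close> and the Ekeland constant
    \<Delta> / r is \<open>s * t / 2\<close>.\<close>
  define s where "s = sqrt (3 * \<eta>)"
  define t where "t = sqrt \<Delta>"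
  have s: "s > 0" "s\<^sup>2 = 3 * \<eta>" and t: "t \<ge> 0" "t\<^sup>2 = \<Delta>"
    using eta_pos \<Delta> by (auto simp: s_def t_def)
  define g where "g y = f y + ereal (\<eta> / 2 * (dist y x)\<^sup>2)" for y
  have g_closed: "closed_fun g"
    unfolding g_def by (intro closed_fun_add_continuous f_closed continuous_intros)
  have g_ge: "ereal m \<le> g y" for y
  proof -
    have "ereal m \<le> fx y" using INF_lower[of y UNIV fx] m by simp
    then show ?thesis
      using model[of y] unfolding g_def close_within_def
      by (cases "fx y"; cases "f y") (auto simp: abs_if split: if_splits)
  qed
  have g_x: "g x = ereal a" by (simp add: g_def a)
  obtain u where u_near: "dist u x \<le> 2 * t / s"
    and u_fin: "g u \<noteq> \<infinity>" and u_min: "\<And>y. g u \<le> g y + ereal (s * t / 2 * dist y u)"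
  \<comment> \<open>Ekeland needs a positive constant. With zero gap, \<open>x\<close> already
    minimises \<open>g\<close> and serves as \<open>u\<close>.\<close>
  proof (cases "t = 0")
    case True
    then have "a = m" using t by (simp add: \<Delta>_def)
    then show thesis using that[of x] g_x g_ge True by simp
  next
    case False
    then have st: "s * t / 2 > 0" using s t by simp
    obtain u where u: "g u + ereal (s * t / 2 * dist u x) \<le> g x"
      "\<And>y. g u \<le> g y + ereal (s * t / 2 * dist y u)"
      using ekeland[OF g_closed g_ge _ st, of x] g_x by auto
    have u_fin: "g u \<noteq> \<infinity>" using u(1) g_x by auto
    \<comment> \<open>The descent from \<open>g x = a\<close> to \<open>g u \<ge> m\<close> is at
      most \<Delta> = \<open>t\<^sup>2\<close>, which gives the radius.\<close>
    have "s * t / 2 * dist u x \<le> \<Delta>"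
      using u(1) g_x g_ge[of u] by (cases "g u") (auto simp: \<Delta>_def)
    then have "dist u x \<le> 2 * t / s"
      using s t(1) False by (simp add: field_simps power2_eq_square flip: t(2))
    then show thesis using that u(2) u_fin by blast
  qed
  have "16 * t\<^sup>2 < (s * \<gamma>)\<^sup>2"
    using \<Delta>(2) t s by (simp add: power_mult_distrib)
  then have "(4 * t)\<^sup>2 < (s * \<gamma>)\<^sup>2" by (simp add: power_mult_distrib)
  then have "4 * t < s * \<gamma>"
    using power2_less_imp_less s gamma_pos by (meson less_imp_le mult_nonneg_nonneg)
  then have "2 * t / s < \<gamma> / 2"
    using s by (simp add: field_simps)
  then have u_ball: "u \<in> ball xstar \<gamma>"
    using u_near near dist_triangle[of xstar u x] by (simp add: dist_commute)
  \<comment> \<open>The second summand is the cross term of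
    \<open>\<eta> / 2 * (dist y u + dist u x)\<^sup>2\<close>; the remaining square in
    \<open>dist y u\<close> is the quadratic term allowed by \<open>slope_le\<close>.\<close>
  define B where "B = s * t / 2 + \<eta> * dist u x"
  have "slope f u \<le> ereal B"
  proof (rule slope_le)
    show "\<bar>f u\<bar> \<noteq> \<infinity>" using u_fin f_range by (auto simp: g_def never_minf_def)
    show "B \<ge> 0" using s t eta_pos by (simp add: B_def)
    show "\<eta> / 2 \<ge> 0" using eta_pos by simp
    fix y
    have "(dist y x)\<^sup>2 \<le> (dist y u + dist u x)\<^sup>2"
      by (intro power_mono dist_triangle) auto
    then have "\<eta> / 2 * (dist y x)\<^sup>2 \<le> \<eta> / 2 * (dist y u + dist u x)\<^sup>2"
      using eta_pos by (intro mult_left_mono) auto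
    then have "\<eta> / 2 * (dist y x)\<^sup>2 + s * t / 2 * dist y u
        \<le> \<eta> / 2 * (dist u x)\<^sup>2 + (B * dist y u + \<eta> / 2 * (dist y u)\<^sup>2)"
      by (simp add: B_def power2_sum algebra_simps)
    then show "f u \<le> f y + ereal (B * dist y u + \<eta> / 2 * (dist y u)\<^sup>2)"
      using u_min[of y] unfolding g_def by (cases "f u"; cases "f y") auto
  qed
  \<comment> \<open>As \<eta> = \<open>s\<^sup>2 / 3\<close>, the second summand is at most
    \<open>2 / 3 * s * t\<close>; rounding it up to \<open>3 / 2 * s * t\<close> gives the total
    \<open>2 * s * t\<close>, which is sqrt (12 \<eta> \<Delta>).\<close>
  also have "B \<le> 2 * s * t"
  proof -
    have "\<eta> * dist u x \<le> s\<^sup>2 / 3 * (2 * t / s)"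
      using u_near eta_pos s by (intro mult_mono) auto
    also have "\<dots> \<le> 3 / 2 * s * t"
      using s(1) t(1) by (simp add: power2_eq_square)
    finally show ?thesis by (simp add: B_def)
  qed
  finally have "slope f u \<le> ereal (2 * s * t)" by simp
  then have "ereal L * slope f u \<le> ereal L * ereal (2 * s * t)"
    using L_pos by (intro ereal_mult_left_mono) auto
  then have "infdist u S \<le> L * (2 * s * t)"
    using slope_bound[OF u_ball] by (metis ereal_less_eq(3) order_trans times_ereal.simps(1))
  then have "infdist x S \<le> L * (2 * s * t) + 2 * t / s"
    using infdist_triangle[of x S u] u_near by (simp add: dist_commute)
  also have "\<dots> = (L * sqrt (12 * \<eta>) + 2 / s) * t"
  proof -
    have "sqrt (12 * \<eta>) = sqrt (2\<^sup>2 * (3 * \<eta>))" by simp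
    also have "\<dots> = 2 * s" unfolding s_def real_sqrt_mult by simp
    finally show ?thesis by (simp add: algebra_simps)
  qed
  finally show ?thesis by (simp add: \<Delta>(3) s_def t_def)
qed

end
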